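(* Consider the stochastic system $X_{t+1}=f(X_t,d_t,t)+w_t$ and the associated deterministic system $x_{t+1}=f(x_t,d_t,t)$ with initial set $\mathcal{X}_0$ and bounded input set $\mathcal{D}$. Let $\varphi$ be a negation-free STL specification with bounded horizon $T\ge1$ built from predicates $\pi_1,\dots,\pi_m$ with superlevel sets $\mathcal{C}_1,\dots,\mathcal{C}_m$, and let $\delta\in(0,1)$. Set $\theta=\delta/T$, let $E_{\theta,t}$ be a PRS of $e_t$ at probability level $1-\theta$ for each $t\in\mathbb{N}_{[0,T]}$, and let $\tilde E_\theta=\bigcup_{t=0}^T E_{\theta,t}$. Let $\tilde\varphi$ be obtained from $\varphi$ by replacing each $\pi_i$ with a predicate $\tilde\pi_i$ whose superlevel set is $\mathcal{C}_i\ominus\tilde E_\theta$, keeping all other operators unchanged. If the deterministic system satisfies $\tilde\varphi$, i.e. $\boldsymbol{x}_{[0,T]}\models\tilde\varphi$ for every $x_0\in\mathcal{X}_0$ and every sequence $d_t\in\mathcal{D}$, $t\in\mathbb{N}_{[0,T]}$, then the stochastic system satisfies $\varphi$ with $1-\delta$ guarantee, i.e. for every $x_0=X_0\in\mathcal{X}_0$ and every sequence $d_t\in\mathcal{D}$, $\mathbb{P}(\boldsymbol{X}_{[0,T]}\models\varphi)\ge1-\delta$.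
   Context: $X_t,x_t\in\mathbb{R}^n$, $d_t\in\mathcal{D}\subset\mathbb{R}^m$ bounded deterministic disturbances, $w_t$ random disturbances in $\mathbb{R}^n$. Associated trajectories share the initial state and the disturbance sequence; the stochastic fluctuation is $e_t=X_t-x_t$. A set $E_{\theta,t}$ is a PRS of $e_t$ at level $1-\theta$ if for any $x_0=X_0\in\mathcal{X}_0$ and any $d_s\in\mathcal{D}$, $0\le s\le t$, $\mathbb{P}(e_t\in E_{\theta,t})\ge1-\theta$. $A\ominus B=\{x:x+y\in A\ \forall y\in B\}$. Negation-free STL: $\varphi::=\mathsf{T}\mid\pi\mid\varphi_1\wedge\varphi_2\mid\varphi_1\vee\varphi_2\mid\varphi_1\mathcal{U}_{[t_1,t_2]}\varphi_2\mid\lozenge_{[t_1,t_2]}\varphi\mid\square_{[t_1,t_2]}\varphi$ with predicates $\pi=(\mu(x)\ge0)$ (superlevel set $\{x:\mu(x)\ge0\}$). Semantics: $\boldsymbol{x}_{[t,\cdot]}\models\pi\iff\mu(x_t)\ge0$; $\wedge,\vee$ as usual; $\varphi_1\mathcal{U}_{[t_1,t_2]}\varphi_2$ holds at $t$ iff some $\tau\in\mathbb{N}_{[t+t_1,t+t_2]}$ has $\varphi_2$ holding at $\tau$ and $\varphi_1$ holding at all $\tau'\in\mathbb{N}_{[t,\tau]}$; $\lozenge_{[t_1,t_2]}\varphi=\mathsf{T}\mathcal{U}_{[t_1,t_2]}\varphi$; $\square_{[t_1,t_2]}\varphi$ holds at $t$ iff $\varphi$ holds at all $\tau\in\mathbb{N}_{[t+t_1,t+t_2]}$.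 The horizon is the trajectory length needed to evaluate the formula: $h^\pi=0$, $h$ of $\wedge,\vee$ is the max, $h^{\varphi_1\mathcal{U}_{[t_1,t_2]}\varphi_2}=t_2+\max(h^{\varphi_1},h^{\varphi_2})$. *)

theory Defs
  imports "HOL-Probability.Probability"
begin

primrec det_traj :: "('a \<Rightarrow> 'b \<Rightarrow> nat \<Rightarrow> 'a) \<Rightarrow> (nat \<Rightarrow> 'b) \<Rightarrow> 'a \<Rightarrow> nat \<Rightarrow> 'a" where
  "det_traj f d x0 0 = x0"
| "det_traj f d x0 (Suc t) = f (det_traj f d x0 t) (d t) t"

text \<open>The noise argument \<open>w\<close> is a sequence of random variables; the trajectory shares the initial
  state \<open>x0\<close> and the input sequence \<open>d\<close> with its associated deterministic trajectory.\<close>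

primrec stoch_traj ::
  "('a::plus \<Rightarrow> 'b \<Rightarrow> nat \<Rightarrow> 'a) \<Rightarrow> (nat \<Rightarrow> 'w \<Rightarrow> 'a) \<Rightarrow> (nat \<Rightarrow> 'b) \<Rightarrow> 'a \<Rightarrow> nat \<Rightarrow> 'w \<Rightarrow> 'a" where
  "stoch_traj f w d x0 0 \<omega> = x0"
| "stoch_traj f w d x0 (Suc t) \<omega> = f (stoch_traj f w d x0 t \<omega>) (d t) t + w t \<omega>"

definition fluctuation ::
  "('a::{plus,minus} \<Rightarrow> 'b \<Rightarrow> nat \<Rightarrow> 'a) \<Rightarrow> (nat \<Rightarrow> 'w \<Rightarrow> 'a) \<Rightarrow> (nat \<Rightarrow> 'b) \<Rightarrow> 'a \<Rightarrow> nat \<Rightarrow> 'w \<Rightarrow> 'a" where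
  "fluctuation f w d x0 t \<omega> = stoch_traj f w d x0 t \<omega> - det_traj f d x0 t"

text \<open>Probabilistic reachable set of the fluctuation at time \<open>t\<close> and level \<open>1 - \<theta>\<close>.\<close>

definition is_prs ::
  "'w measure \<Rightarrow> ('a::{plus,minus} \<Rightarrow> 'b \<Rightarrow> nat \<Rightarrow> 'a) \<Rightarrow> (nat \<Rightarrow> 'w \<Rightarrow> 'a) \<Rightarrow> 'a set \<Rightarrow> 'b set
    \<Rightarrow> real \<Rightarrow> nat \<Rightarrow> 'a set \<Rightarrow> bool" where
  "is_prs M f w X0 D \<theta> t E \<longleftrightarrow>
     (\<forall>x0\<in>X0. \<forall>d. (\<forall>s\<le>t. d s \<in> D) \<longrightarrow>
        measure M {\<omega> \<in> space M. fluctuation f w d x0 t \<omega> \<in> E} \<ge> 1 - \<theta>)"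

definition minkowski_diff :: "'a::plus set \<Rightarrow> 'a set \<Rightarrow> 'a set" (infixl "\<ominus>" 65) where
  "A \<ominus> B = {x. \<forall>y\<in>B. x + y \<in> A}"

definition superlevel :: "('a \<Rightarrow> real) \<Rightarrow> 'a set" where
  "superlevel \<mu> = {x. \<mu> x \<ge> 0}"

text \<open>Negation-free STL over atoms of an arbitrary type. The semantics takes atoms to be functions
  \<open>\<mu>\<close>, read as the predicate \<open>\<mu>(x) \<ge> 0\<close>. A formula whose atoms are indices \<open>i\<close> is turned into such a
  formula by \<open>map_stl \<mu>\<close>, which puts \<open>\<mu> i\<close> in place of \<open>i\<close> and keeps all operators.\<close>

datatype 'p stl =
    Tru
  | Pred 'p
  | Conj "'p stl" "'p stl"
  | Disj "'p stl" "'p stl"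
  | Until nat nat "'p stl" "'p stl"
  | Eventually nat nat "'p stl"
  | Always nat nat "'p stl"

primrec wf_intervals :: "'p stl \<Rightarrow> bool" where
  "wf_intervals Tru \<longleftrightarrow> True"
| "wf_intervals (Pred p) \<longleftrightarrow> True"
| "wf_intervals (Conj \<phi> \<psi>) \<longleftrightarrow> wf_intervals \<phi> \<and> wf_intervals \<psi>"
| "wf_intervals (Disj \<phi> \<psi>) \<longleftrightarrow> wf_intervals \<phi> \<and> wf_intervals \<psi>"
| "wf_intervals (Until a b \<phi> \<psi>) \<longleftrightarrow> a \<le> b \<and> wf_intervals \<phi> \<and> wf_intervals \<psi>"
| "wf_intervals (Eventually a b \<phi>) \<longleftrightarrow> a \<le> b \<and> wf_intervals \<phi>"
| "wf_intervals (Always a b \<phi>) \<longleftrightarrow> a \<le> b \<and> wf_intervals \<phi>"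

primrec horizon :: "'p stl \<Rightarrow> nat" where
  "horizon Tru = 0"
| "horizon (Pred p) = 0"
| "horizon (Conj \<phi> \<psi>) = max (horizon \<phi>) (horizon \<psi>)"
| "horizon (Disj \<phi> \<psi>) = max (horizon \<phi>) (horizon \<psi>)"
| "horizon (Until a b \<phi> \<psi>) = b + max (horizon \<phi>) (horizon \<psi>)"
| "horizon (Eventually a b \<phi>) = b + horizon \<phi>"
| "horizon (Always a b \<phi>) = b + horizon \<phi>"

text \<open>\<open>sat x t \<phi>\<close>: the trajectory \<open>x\<close> satisfies \<open>\<phi>\<close> at time \<open>t\<close>. A finite trajectory
  \<open>x\<^sub>0, \<dots>, x\<^sub>T\<close> is represented by a total function; lemma \<open>sat_cong_horizon\<close> below shows that its
  values beyond the horizon are irrelevant.\<close>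

primrec sat :: "(nat \<Rightarrow> 'a) \<Rightarrow> nat \<Rightarrow> ('a \<Rightarrow> real) stl \<Rightarrow> bool" where
  "sat x t Tru \<longleftrightarrow> True"
| "sat x t (Pred \<mu>) \<longleftrightarrow> \<mu> (x t) \<ge> 0"
| "sat x t (Conj \<phi> \<psi>) \<longleftrightarrow> sat x t \<phi> \<and> sat x t \<psi>"
| "sat x t (Disj \<phi> \<psi>) \<longleftrightarrow> sat x t \<phi> \<or> sat x t \<psi>"
| "sat x t (Until a b \<phi> \<psi>) \<longleftrightarrow>
     (\<exists>\<tau>\<in>{t+a..t+b}. sat x \<tau> \<psi> \<and> (\<forall>\<tau>'\<in>{t..\<tau>}. sat x \<tau>' \<phi>))"
| "sat x t (Eventually a b \<phi>) \<longleftrightarrow> (\<exists>\<tau>\<in>{t+a..t+b}. sat x \<tau> \<phi>)"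
| "sat x t (Always a b \<phi>) \<longleftrightarrow> (\<forall>\<tau>\<in>{t+a..t+b}. sat x \<tau> \<phi>)"

lemma sat_Eventually_Until: "sat x t (Eventually a b \<phi>) \<longleftrightarrow> sat x t (Until a b Tru \<phi>)"
  by simp

lemma horizon_Eventually_Until: "horizon (Eventually a b \<phi>) = horizon (Until a b Tru \<phi>)"
  by simp

lemma sat_cong_horizon:
  assumes "\<And>s. s \<le> t + horizon \<phi> \<Longrightarrow> x s = y s"
  shows "sat x t \<phi> \<longleftrightarrow> sat y t \<phi>"
  using assms
proof (induction \<phi> arbitrary: t)
  case (Until a b \<phi> \<psi>)
  have "sat x \<tau> \<phi> = sat y \<tau> \<phi>" "sat x \<tau> \<psi> = sat y \<tau> \<psi>" if "\<tau> \<le> t + b" for \<tau>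
    by (rule Until.IH, rule Until.prems, use that in simp)+
  then show ?case by (auto intro!: bex_cong)
next
  case (Eventually a b \<phi>)
  have "sat x \<tau> \<phi> = sat y \<tau> \<phi>" if "\<tau> \<le> t + b" for \<tau>
    by (rule Eventually.IH, rule Eventually.prems, use that in simp)
  then show ?case by auto
next
  case (Always a b \<phi>)
  have "sat x \<tau> \<phi> = sat y \<tau> \<phi>" if "\<tau> \<le> t + b" for \<tau>
    by (rule Always.IH, rule Always.prems, use that in simp)
  then show ?case by auto
next
  case (Conj \<phi> \<psi>)
  have "sat x t \<phi> = sat y t \<phi>" "sat x t \<psi> = sat y t \<psi>"
    by (rule Conj.IH, rule Conj.prems, simp)+
  then show ?case by simp
next
  case (Disj \<phi> \<psi>)
  have "sat x t \<phi> = sat y t \<phi>" "sat x t \<psi> = sat y t \<psi>"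
    by (rule Disj.IH, rule Disj.prems, simp)+
  then show ?case by simp
qed simp_all

end

theory Submission
  imports Defs
begin

text \<open>On the event that \<open>e\<^sub>t\<close> lies in \<open>E'\<close> for all \<open>t \<le> T\<close>, every predicate that the tightened
  formula sees as true at \<open>x\<^sub>t\<close> is true at \<open>X\<^sub>t = x\<^sub>t + e\<^sub>t\<close>, and negation-free formulas are monotone
  in their atoms. The complement of that event is covered by the \<open>T\<close> events that \<open>e\<^sub>t\<close> misses
  \<open>E\<^sub>t\<close>, \<open>1 \<le> t \<le> T\<close>: time \<open>0\<close> costs nothing, because \<open>e\<^sub>0 = 0\<close> is deterministic and
  hence lies in \<open>E\<^sub>0\<close> surely. This is why \<open>\<theta> = \<delta> / T\<close> suffices for \<open>T + 1\<close> time steps.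
  The sets \<open>E\<^sub>t\<close> are not assumed measurable; the events \<open>e\<^sub>t \<in> E\<^sub>t\<close> nevertheless are, since a
  non-measurable set has measure \<open>0\<close> in Isabelle, below the level \<open>1 - \<theta> > 0\<close>.\<close>

text \<open>Without negation, every operator preserves implications between its arguments, so
  induction on the formula works. Two trajectories appear because the tightened atoms are read along
  the deterministic one and the original atoms along the stochastic one. Times are cut at the
  horizon since fluctuations are controlled only up to \<open>T\<close>.\<close>

lemma sat_map_stl_mono:
  assumes "sat x t (map_stl \<mu>' \<phi>)"
    and "\<And>i s. i \<in> set_stl \<phi> \<Longrightarrow> s \<le> t + horizon \<phi> \<Longrightarrow> \<mu>' i (x s) \<ge> 0 \<Longrightarrow> \<mu> i (y s) \<ge> 0"
  shows "sat y t (map_stl \<mu> \<phi>)"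
  using assms
proof (induction \<phi> arbitrary: t)
  case (Conj \<phi> \<psi>)
  have "sat y t (map_stl \<mu> \<phi>)" "sat y t (map_stl \<mu> \<psi>)"
    using Conj.prems by (auto intro!: Conj.IH)
  then show ?case by simp
next
  case (Disj \<phi> \<psi>)
  have "sat x t (map_stl \<mu>' \<phi>) \<Longrightarrow> sat y t (map_stl \<mu> \<phi>)"
    "sat x t (map_stl \<mu>' \<psi>) \<Longrightarrow> sat y t (map_stl \<mu> \<psi>)"
    using Disj.prems(2) by (auto intro!: Disj.IH)
  then show ?case using Disj.prems(1) by auto
next
  case (Until a b \<phi> \<psi>)
  \<comment> \<open>The horizon of \<open>Until\<close> is \<open>b\<close> plus the larger
    subhorizon, so from any \<open>\<tau> \<le> t + b\<close> neither argument looks beyond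
    \<open>t + horizon\<close>.\<close>
  have "sat x \<tau> (map_stl \<mu>' \<phi>) \<Longrightarrow> sat y \<tau> (map_stl \<mu> \<phi>)"
    "sat x \<tau> (map_stl \<mu>' \<psi>) \<Longrightarrow> sat y \<tau> (map_stl \<mu> \<psi>)" if "\<tau> \<le> t + b" for \<tau>
    using Until.prems(2) that by (auto intro!: Until.IH)
  moreover obtain \<tau> where \<tau>: "\<tau> \<in> {t + a..t + b}" "sat x \<tau> (map_stl \<mu>' \<psi>)"
    "\<And>\<tau>'. \<tau>' \<in> {t..\<tau>} \<Longrightarrow> sat x \<tau>' (map_stl \<mu>' \<phi>)"
    using Until.prems(1) by auto
  ultimately have "sat y \<tau> (map_stl \<mu> \<psi>)" "\<forall>\<tau>'\<in>{t..\<tau>}. sat y \<tau>' (map_stl \<mu> \<phi>)"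
    by auto
  then show ?case using \<tau>(1) unfolding stl.map sat.simps by blast
next
  case (Eventually a b \<phi>)
  have "sat x \<tau> (map_stl \<mu>' \<phi>) \<Longrightarrow> sat y \<tau> (map_stl \<mu> \<phi>)" if "\<tau> \<le> t + b" for \<tau>
    using Eventually.prems(2) that by (auto intro!: Eventually.IH)
  then show ?case using Eventually.prems(1) unfolding stl.map sat.simps by (meson atLeastAtMost_iff)
next
  case (Always a b \<phi>)
  have "sat x \<tau> (map_stl \<mu>' \<phi>) \<Longrightarrow> sat y \<tau> (map_stl \<mu> \<phi>)" if "\<tau> \<le> t + b" for \<tau>
    using Always.prems(2) that by (auto intro!: Always.IH)
  then show ?case using Always.prems(1) unfolding stl.map sat.simps by (meson atLeastAtMost_iff)
qed simp_all

text \<open>Time windows are finite sets of naturals, so satisfaction is a finite Boolean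
  combination of atomic events.\<close>

lemma pred_sat_map_stl:
  assumes "\<And>i s. i \<in> set_stl \<phi> \<Longrightarrow> s \<le> t + horizon \<phi> \<Longrightarrow> Measurable.pred M (\<lambda>\<omega>. \<mu> i (X s \<omega>) \<ge> 0)"
  shows "Measurable.pred M (\<lambda>\<omega>. sat (\<lambda>s. X s \<omega>) t (map_stl \<mu> \<phi>))"
  using assms
proof (induction \<phi> arbitrary: t)
  case (Conj \<phi> \<psi>)
  have "Measurable.pred M (\<lambda>\<omega>. sat (\<lambda>s. X s \<omega>) t (map_stl \<mu> \<phi>))"
    "Measurable.pred M (\<lambda>\<omega>. sat (\<lambda>s. X s \<omega>) t (map_stl \<mu> \<psi>))"
    using Conj.prems by (auto intro!: Conj.IH)
  then show ?case by simp
next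
  case (Disj \<phi> \<psi>)
  have "Measurable.pred M (\<lambda>\<omega>. sat (\<lambda>s. X s \<omega>) t (map_stl \<mu> \<phi>))"
    "Measurable.pred M (\<lambda>\<omega>. sat (\<lambda>s. X s \<omega>) t (map_stl \<mu> \<psi>))"
    using Disj.prems by (auto intro!: Disj.IH)
  then show ?case by simp
next
  case (Until a b \<phi> \<psi>)
  have "Measurable.pred M (\<lambda>\<omega>. sat (\<lambda>s. X s \<omega>) \<tau> (map_stl \<mu> \<phi>))"
    "Measurable.pred M (\<lambda>\<omega>. sat (\<lambda>s. X s \<omega>) \<tau> (map_stl \<mu> \<psi>))" if "\<tau> \<le> t + b" for \<tau>
    using Until.prems that by (auto intro!: Until.IH)
  then show ?case
    unfolding stl.map sat.simps
    by (intro pred_intros_finite pred_intros_logic) auto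
next
  case (Eventually a b \<phi>)
  have "Measurable.pred M (\<lambda>\<omega>. sat (\<lambda>s. X s \<omega>) \<tau> (map_stl \<mu> \<phi>))" if "\<tau> \<le> t + b" for \<tau>
    using Eventually.prems that by (auto intro!: Eventually.IH)
  then show ?case
    unfolding stl.map sat.simps by (intro pred_intros_finite) auto
next
  case (Always a b \<phi>)
  have "Measurable.pred M (\<lambda>\<omega>. sat (\<lambda>s. X s \<omega>) \<tau> (map_stl \<mu> \<phi>))" if "\<tau> \<le> t + b" for \<tau>
    using Always.prems that by (auto intro!: Always.IH)
  then show ?case
    unfolding stl.map sat.simps by (intro pred_intros_finite) auto
qed simp_all

lemma borel_measurable_stoch_traj:
  fixes f :: "'a::{second_countable_topology, real_normed_vector} \<Rightarrow> 'b \<Rightarrow> nat \<Rightarrow> 'a"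
  assumes "\<And>s. s < t \<Longrightarrow> w s \<in> borel_measurable M"
    and "\<And>s. s < t \<Longrightarrow> (\<lambda>x. f x (d s) s) \<in> borel_measurable borel"
  shows "stoch_traj f w d x0 t \<in> borel_measurable M"
  using assms
proof (induction t)
  case 0
  have "stoch_traj f w d x0 0 = (\<lambda>_. x0)" by (rule ext) simp
  then show ?case by simp
next
  case (Suc t)
  have "stoch_traj f w d x0 t \<in> borel_measurable M"
    using Suc.prems by (intro Suc.IH) auto
  from measurable_compose[OF this Suc.prems(2)[OF lessI]] Suc.prems(1)[OF lessI]
  have "(\<lambda>\<omega>. f (stoch_traj f w d x0 t \<omega>) (d t) t + w t \<omega>) \<in> borel_measurable M"
    by (rule borel_measurable_add)
  moreover have "stoch_traj f w d x0 (Suc t) = (\<lambda>\<omega>. f (stoch_traj f w d x0 t \<omega>) (d t) t + w t \<omega>)"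
    by (rule ext) simp
  ultimately show ?case by simp
qed

text \<open>Union bound on the complements; no independence is involved. Intersecting with
  \<open>space M\<close> gives the right value for empty \<open>I\<close>, where the inner
  intersection is \<open>UNIV\<close>.\<close>

lemma (in prob_space) prob_Inter_ge:
  assumes "finite I" and "\<And>i. i \<in> I \<Longrightarrow> A i \<in> events" and "\<And>i. i \<in> I \<Longrightarrow> prob (A i) \<ge> 1 - \<theta>"
  shows "prob (space M \<inter> (\<Inter>i\<in>I. A i)) \<ge> 1 - real (card I) * \<theta>"
proof -
  have "prob (\<Union>i\<in>I. space M - A i) \<le> (\<Sum>i\<in>I. prob (space M - A i))"
    using assms by (intro finite_measure_subadditive_finite) auto
  also have "\<dots> \<le> (\<Sum>i\<in>I. \<theta>)"
  proof (rule sum_mono)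
    fix i assume "i \<in> I"
    then show "prob (space M - A i) \<le> \<theta>"
      using assms(2,3)[of i] by (simp add: prob_compl)
  qed
  finally have "prob (\<Union>i\<in>I. space M - A i) \<le> real (card I) * \<theta>" by simp
  moreover have "space M \<inter> (\<Inter>i\<in>I. A i) = space M - (\<Union>i\<in>I. space M - A i)" by auto
  moreover have "(\<Union>i\<in>I. space M - A i) \<in> events"
    using assms by (intro sets.finite_UN) auto
  ultimately show ?thesis by (simp add: prob_compl)
qed

theorem theorem2:
  fixes M :: "'w measure"
    and f :: "real^'n \<Rightarrow> real^'m \<Rightarrow> nat \<Rightarrow> real^'n"
    and w :: "nat \<Rightarrow> 'w \<Rightarrow> real^'n"
    and X0 :: "(real^'n) set"
    and D :: "(real^'m) set"
    and k T :: nat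
    and \<phi> :: "nat stl"
    and \<mu> \<mu>' :: "nat \<Rightarrow> real^'n \<Rightarrow> real"
    and C E :: "nat \<Rightarrow> (real^'n) set"
    and E' :: "(real^'n) set"
    and \<delta> \<theta> :: real
  assumes "prob_space M"
    and "\<And>t. w t \<in> borel_measurable M"
    and "\<And>d t. d \<in> D \<Longrightarrow> (\<lambda>x. f x d t) \<in> borel_measurable borel"
    and "bounded D"
    and "wf_intervals \<phi>"
    and "set_stl \<phi> \<subseteq> {1..k}"
    and "horizon \<phi> \<le> T"
    and "T \<ge> 1"
    and "\<And>i. i \<in> {1..k} \<Longrightarrow> C i = superlevel (\<mu> i)"
    and "\<And>i. i \<in> {1..k} \<Longrightarrow> C i \<in> sets borel"
    and "0 < \<delta>" and "\<delta> < 1"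
    and "\<theta> = \<delta> / real T"
    and "\<And>t. t \<in> {0..T} \<Longrightarrow> is_prs M f w X0 D \<theta> t (E t)"
    and "E' = (\<Union>t\<in>{0..T}. E t)"
    and "\<And>i. i \<in> {1..k} \<Longrightarrow> superlevel (\<mu>' i) = C i \<ominus> E'"
    and "\<forall>x0\<in>X0. \<forall>d. (\<forall>t\<in>{0..T}. d t \<in> D) \<longrightarrow>
           sat (det_traj f d x0) 0 (map_stl \<mu>' \<phi>)"
  shows "\<forall>x0\<in>X0. \<forall>d. (\<forall>t\<in>{0..T}. d t \<in> D) \<longrightarrow>
           measure M {\<omega> \<in> space M. sat (\<lambda>t. stoch_traj f w d x0 t \<omega>) 0 (map_stl \<mu> \<phi>)} \<ge> 1 - \<delta>"
proof (intro ballI allI impI)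
  fix x0 d
  assume x0: "x0 \<in> X0" and d: "\<forall>t\<in>{0..T}. d t \<in> D"
  interpret prob_space M by fact
  let ?X = "stoch_traj f w d x0" and ?x = "det_traj f d x0" and ?e = "fluctuation f w d x0"
  define A where "A t = {\<omega> \<in> space M. ?e t \<omega> \<in> E t}" for t
  let ?S = "{\<omega> \<in> space M. sat (\<lambda>t. ?X t \<omega>) 0 (map_stl \<mu> \<phi>)}"
  have "\<delta> / real T \<le> \<delta>" using assms(8,11) by (simp add: divide_le_eq)
  then have \<theta>: "\<theta> < 1" using assms(12,13) by linarith
  have A_prob: "prob (A t) \<ge> 1 - \<theta>" if "t \<le> T" for t
    using assms(14)[of t] that x0 d by (auto simp: is_prs_def A_def)
  have A_sets: "A t \<in> events" if "t \<le> T" for t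
    using A_prob[OF that] \<theta> measure_notin_sets[of "A t" M] by fastforce
  \<comment> \<open>Positive probability yields one outcome in \<open>A 0\<close>; as
    \<open>?e 0\<close> does not depend on the outcome, that one witness settles all of
    them.\<close>
  have "A 0 \<noteq> {}" using A_prob[of 0] \<theta> by auto
  then have e0: "?e 0 \<omega> \<in> E 0" for \<omega> by (auto simp: A_def fluctuation_def)
  have X_meas: "?X t \<in> borel_measurable M" if "t \<le> T" for t
    using that d assms(2,3) by (intro borel_measurable_stoch_traj) auto
  have S_sets: "?S \<in> events"
  proof -
    have "Measurable.pred M (\<lambda>\<omega>. \<mu> i (?X s \<omega>) \<ge> 0)" if "i \<in> set_stl \<phi>" "s \<le> 0 + horizon \<phi>" for i s
    proof -
      have i: "i \<in> {1..k}" and s: "s \<le> T" using that assms(6,7) by auto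
      \<comment> \<open>What is known to be Borel is the superlevel set \<open>C i\<close>, not the
        function \<open>\<mu> i\<close>, so the event is obtained as a preimage of
        \<open>C i\<close>.\<close>
      have "?X s -` C i \<inter> space M \<in> events"
        using measurable_sets[OF X_meas[OF s] assms(10)[OF i]] .
      moreover have "?X s -` C i \<inter> space M = {\<omega> \<in> space M. \<mu> i (?X s \<omega>) \<ge> 0}"
        using assms(9)[OF i] by (auto simp: superlevel_def)
      ultimately show ?thesis by (simp add: pred_def)
    qed
    then show ?thesis using pred_sat_map_stl[where t = 0 and X = ?X and \<mu> = \<mu>] by (simp add: pred_def)
  qed
  have sat_det: "sat ?x 0 (map_stl \<mu>' \<phi>)" using assms(17) x0 d by blast
  have "space M \<inter> (\<Inter>t\<in>{1..T}. A t) \<subseteq> ?S"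
  proof
    fix \<omega> assume \<omega>: "\<omega> \<in> space M \<inter> (\<Inter>t\<in>{1..T}. A t)"
    have e: "?e t \<omega> \<in> E'" if "t \<le> T" for t
    proof -
      have "?e t \<omega> \<in> E t"
        using \<omega> that e0 by (cases "t = 0") (auto simp: A_def)
      then show ?thesis using that assms(15) by auto
    qed
    have "sat (\<lambda>t. ?X t \<omega>) 0 (map_stl \<mu> \<phi>)"
    proof (rule sat_map_stl_mono[OF sat_det])
      fix i s assume "i \<in> set_stl \<phi>" "s \<le> 0 + horizon \<phi>" "\<mu>' i (?x s) \<ge> 0"
      then have i: "i \<in> {1..k}" and s: "s \<le> T" and "?x s \<in> superlevel (\<mu>' i)"
        using assms(6,7) by (auto simp: superlevel_def)
      \<comment> \<open>The Minkowski difference is instantiated at the realised fluctuation, and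
        the sum is \<open>?X s \<omega>\<close>.\<close>
      then have "?x s + ?e s \<omega> \<in> C i"
        using assms(16)[OF i] e[OF s] by (auto simp: minkowski_diff_def)
      then show "\<mu> i (?X s \<omega>) \<ge> 0"
        using assms(9)[OF i] by (simp add: fluctuation_def superlevel_def)
    qed
    then show "\<omega> \<in> ?S" using \<omega> by simp
  qed
  \<comment> \<open>Monotonicity needs the larger set \<open>?S\<close> to be an event, which is the
    purpose of \<open>S_sets\<close>.\<close>
  then have "prob (space M \<inter> (\<Inter>t\<in>{1..T}. A t)) \<le> prob ?S"
    using S_sets by (rule finite_measure_mono)
  moreover have "prob (space M \<inter> (\<Inter>t\<in>{1..T}. A t)) \<ge> 1 - real (card {1..T}) * \<theta>"
    using A_sets A_prob by (intro prob_Inter_ge) auto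
  \<comment> \<open>The factor is \<open>T\<close>, not \<open>T + 1\<close>, because the index
    starts at 1; \<open>T \<ge> 1\<close> lets it cancel in
    \<open>\<delta> / real T\<close>.\<close>
  moreover have "real (card {1..T}) * \<theta> = \<delta>" using assms(8,13) by simp
  ultimately show "prob ?S \<ge> 1 - \<delta>" by linarith
qed

end
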